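(* Let $p$ be a prime number, and let $g(x) = b_e x^e + b_{e-1} x^{e-1} + \cdots + b_0$ with $b_0 \neq 0$ be a polynomial of degree $e$ with rational coefficients. Let $m_0, m_1, \dots, m_{t-1}, m_t$ be integers, with $m_0=e$ and $m_t=0$, such that the successive vertices of the Newton polygon of $g(x)$ with respect to $p$ are given by the set $$\{(0, \nu_p(b_e)), (e - m_1, \nu_p(b_{m_1})), \dots, (e - m_{t-1}, \nu_p(b_{m_{t-1}})), (e, \nu_p(b_0))\},$$ and put $\lambda_i = \frac{\nu_p(b_{m_i}) - \nu_p(b_{m_{i-1}})}{m_{i-1} - m_i}$ for $1 \leq i \leq t$. Let $u$ be an integer such that $u > |\lambda_j|$ for all $j \in \{1,2, \ldots, t\}$. Suppose $f(x) = a_d x^d + \cdots + a_1 x + a_0\in\mathbb{Q}[x]$ is a polynomial of degree $d$ such that $\nu_p(a_d)=0$ and $\nu_p(a_i) \geq \frac{u}{\beta} (d-i)$ for all $i \in \{ 0,1,2, \ldots, d \}$, where $\beta \leq d$ is a positive integer coprime to $u$. Then for every positive integer $n$, the successive vertices of the Newton polygon of $(g\circ f^n)(x)$ with respect to $p$ are given by the set $$\{(0, \nu_p(b_e)), (d^n(e - m_1), \nu_p(b_{m_1})), \dots, (d^n(e - m_{t-1}), \nu_p(b_{m_{t-1}})), (d^ne, \nu_p(b_0))\}.$$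
   Context: $\nu_p$ denotes the $p$-adic valuation on $\mathbb{Q}$, with $\nu_p(0)=+\infty$. For a polynomial $h(x)=\sum_{i=0}^{N} c_i x^i\in\mathbb{Q}[x]$ of degree $N$ with $h(0)\neq 0$, the Newton polygon of $h$ with respect to $p$ is the polygonal path formed by the lower edges along the convex hull in $\mathbb{R}^2$ of the points $(N-i,\nu_p(c_i))$, $0\le i\le N$ (points with $c_i=0$ are ignored). Its successive vertices, listed from left to right, are its two endpoints and the points where the slope changes. $f^n$ denotes the $n$-th iterate (composition) of $f$. *)

theory Defs
  imports "HOL-Analysis.Analysis" "HOL-Computational_Algebra.Computational_Algebra"
begin

definition padic_val :: "nat \<Rightarrow> rat \<Rightarrow> ereal" where
  "padic_val p x =
     (if x = 0 then \<infinity>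
      else ereal (real (multiplicity (int p) (fst (quotient_of x)))
                - real (multiplicity (int p) (snd (quotient_of x)))))"

text \<open>Zero coefficients contribute no point: their valuation is infinite, hence not of the
  form \<open>ereal y\<close>.\<close>

definition newton_points :: "nat \<Rightarrow> rat poly \<Rightarrow> (real \<times> real) set" where
  "newton_points p h =
     {(x, y). \<exists>i\<le>degree h. x = real (degree h) - real i \<and> ereal y = padic_val p (coeff h i)}"

text \<open>The polygonal path, as a subset of the plane: the lower boundary of the convex hull.\<close>

definition newton_polygon :: "nat \<Rightarrow> rat poly \<Rightarrow> (real \<times> real) set" where
  "newton_polygon p h =
     {(x, y). (x, y) \<in> convex hull (newton_points p h) \<and>
              (\<forall>y'. (x, y') \<in> convex hull (newton_points p h) \<longrightarrow> y \<le> y')}"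

text \<open>The slope of the path \<open>C\<close> changes at a point if, near that point, \<open>C\<close> consists of two
  segments of different slopes meeting there.\<close>

definition slope_changes_at :: "(real \<times> real) set \<Rightarrow> real \<times> real \<Rightarrow> bool" where
  "slope_changes_at C v \<longleftrightarrow>
     (\<exists>s1 s2 \<epsilon>. s1 \<noteq> s2 \<and> \<epsilon> > 0 \<and>
        (\<forall>r\<in>{0..\<epsilon>}. (fst v - r, snd v - s1 * r) \<in> C \<and> (fst v + r, snd v + s2 * r) \<in> C))"

definition newton_vertices :: "nat \<Rightarrow> rat poly \<Rightarrow> (real \<times> real) set" where
  "newton_vertices p h =
     {v \<in> newton_polygon p h.
        (\<forall>w\<in>newton_polygon p h. fst v \<le> fst w) \<or>
        (\<forall>w\<in>newton_polygon p h. fst w \<le> fst v) \<or>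
        slope_changes_at (newton_polygon p h) v}"

definition successive_newton_vertices :: "nat \<Rightarrow> rat poly \<Rightarrow> (real \<times> real) list \<Rightarrow> bool" where
  "successive_newton_vertices p h vs \<longleftrightarrow>
     sorted_wrt (\<lambda>v w. fst v < fst w) vs \<and> set vs = newton_vertices p h"

definition poly_iterate :: "'a::comm_semiring_1 poly \<Rightarrow> nat \<Rightarrow> 'a poly" where
  "poly_iterate f n = (pcompose f ^^ n) [:0, 1:]"

end

theory Submission
  imports Defs
begin

text \<open>
  Weaken the hypothesis on \<open>f\<close> to \<open>v(a\<^sub>i) \<ge> u (1 - i/d)\<close>, using \<open>\<beta> \<le> d\<close>. In this form it is stable
  under composition: \<open>F = f\<^sup>n\<close>, of degree \<open>D = d\<^sup>n\<close>, has a leading coefficient of valuation \<open>0\<close> and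
  \<open>v(F\<^sub>k) \<ge> u (1 - k/D)\<close>. Hence the Newton polygon of the summand \<open>b\<^sub>j F\<^sup>j\<close> of \<open>g \<circ> F\<close>, compressed
  horizontally by \<open>D\<close>, starts at the point \<open>(e - j, v(b\<^sub>j))\<close> and lies above the line of slope \<open>u\<close> from
  there. All slopes of the polygon of \<open>g\<close> are below \<open>u\<close>, so this line stays above that polygon, and
  strictly so to the right of its starting point. Therefore every point of \<open>g \<circ> F\<close> lies above the
  stretched polygon of \<open>g\<close>, and no cancellation occurs at a vertex of \<open>g\<close>, so the polygon of \<open>g \<circ> F\<close>
  is the stretched polygon of \<open>g\<close>.
\<close>

section \<open>The p-adic valuation\<close>

text \<open>Cross-multiplying with the reduced fraction from \<open>quotient_of\<close> and
  comparing multiplicities shows that reduction does not change the difference. Sums and products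
  can thus be treated through unreduced fractions.\<close>

lemma padic_val_fraction:
  fixes a b :: int
  assumes "prime p" "a \<noteq> 0" "b \<noteq> 0"
  shows "padic_val p (of_int a / of_int b) =
    ereal (real (multiplicity (int p) a) - real (multiplicity (int p) b))"
proof -
  have p: "prime_elem (int p)" using assms(1) by simp
  define r :: rat where "r = of_int a / of_int b"
  obtain n d where nd: "quotient_of r = (n, d)" by force
  have d: "d > 0" using quotient_of_denom_pos[OF nd] .
  have r: "r = of_int n / of_int d" using quotient_of_div[OF nd] .
  have "r \<noteq> 0" using assms by (simp add: r_def)
  with r have n: "n \<noteq> 0" by auto
  have "(of_int (a * d) :: rat) = of_int (n * b)"
    using r d assms(3) by (simp add: r_def field_simps)
  then have "a * d = n * b" by (simp only: of_int_eq_iff)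
  then have "multiplicity (int p) a + multiplicity (int p) d =
      multiplicity (int p) n + multiplicity (int p) b"
    using prime_elem_multiplicity_mult_distrib[OF p] assms d n by (metis less_irrefl)
  then have "real (multiplicity (int p) a) + real (multiplicity (int p) d) =
      real (multiplicity (int p) n) + real (multiplicity (int p) b)"
    by (metis of_nat_add)
  then show ?thesis
    using \<open>r \<noteq> 0\<close> nd by (simp add: padic_val_def flip: r_def)
qed

lemma rat_fraction_cases:
  fixes x :: rat
  assumes "x \<noteq> 0"
  obtains a b :: int where "x = of_int a / of_int b" "a \<noteq> 0" "b \<noteq> 0"
proof -
  obtain n d where nd: "quotient_of x = (n, d)" by force
  then have "x = of_int n / of_int d" "d > 0"
    using quotient_of_div quotient_of_denom_pos by auto
  then show ?thesis using assms by (intro that[of n d]) auto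
qed

lemma padic_val_0 [simp]: "padic_val p 0 = \<infinity>"
  by (simp add: padic_val_def)

lemma padic_val_1 [simp]: "padic_val p 1 = 0"
  by (simp add: padic_val_def)

lemma padic_val_mult:
  assumes "prime p"
  shows "padic_val p (x * y) = padic_val p x + padic_val p y"
proof (cases "x = 0 \<or> y = 0")
  case False
  then obtain a b c d :: int where
    x: "x = of_int a / of_int b" "a \<noteq> 0" "b \<noteq> 0" and
    y: "y = of_int c / of_int d" "c \<noteq> 0" "d \<noteq> 0"
    by (metis rat_fraction_cases)
  have "x * y = of_int (a * c) / of_int (b * d)" by (simp add: x y)
  then have "padic_val p (x * y) =
      ereal (real (multiplicity (int p) (a * c)) - real (multiplicity (int p) (b * d)))"
    using padic_val_fraction[OF assms, of "a * c" "b * d"] x y by simp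
  then show ?thesis
    using x y assms padic_val_fraction[OF assms]
    by (simp add: prime_elem_multiplicity_mult_distrib)
qed auto

lemma padic_val_power_eq_0:
  assumes "prime p" "padic_val p x = 0"
  shows "padic_val p (x ^ n) = 0"
  by (induction n) (simp_all add: padic_val_mult assms)

text \<open>Over the common denominator \<open>b * d\<close>, the ultrametric inequality comes down
  to this: the smaller of the two powers of \<open>p\<close> divides both summands of the
  numerator.\<close>

lemma padic_val_add_ge:
  assumes "prime p"
  shows "min (padic_val p x) (padic_val p y) \<le> padic_val p (x + y)"
proof (cases "x = 0 \<or> y = 0 \<or> x + y = 0")
  case False
  then obtain a b c d :: int where
    x: "x = of_int a / of_int b" "a \<noteq> 0" "b \<noteq> 0" and
    y: "y = of_int c / of_int d" "c \<noteq> 0" "d \<noteq> 0"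
    by (metis rat_fraction_cases)
  have sum: "x + y = of_int (a * d + c * b) / of_int (b * d)"
    using x y by (simp add: field_simps)
  have "rat_of_int (a * d + c * b) \<noteq> 0"
  proof
    assume "rat_of_int (a * d + c * b) = 0"
    then have "x + y = 0" unfolding sum by (simp only: div_0)
    with False show False by blast
  qed
  then have nz: "a * d + c * b \<noteq> 0" by (metis of_int_0)
  let ?v = "multiplicity (int p)"
  have p: "prime_elem (int p)" using assms by simp
  have "int p ^ min (?v (a * d)) (?v (c * b)) dvd a * d + c * b"
    by (intro dvd_add multiplicity_dvd') simp_all
  then have "?v (a * d + c * b) \<ge> min (?v (a * d)) (?v (c * b))"
    using nz prime_elem_not_unit[OF p] by (intro multiplicity_geI)
  moreover have "?v (a * d) = ?v a + ?v d" "?v (c * b) = ?v c + ?v b" "?v (b * d) = ?v b + ?v d"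
    using x y p by (simp_all add: prime_elem_multiplicity_mult_distrib)
  moreover have "padic_val p (x + y) = ereal (real (?v (a * d + c * b)) - real (?v (b * d)))"
    using padic_val_fraction[OF assms nz, of "b * d"] x y unfolding sum by simp
  moreover have "padic_val p x = ereal (real (?v a) - real (?v b))"
    "padic_val p y = ereal (real (?v c) - real (?v d))"
    using padic_val_fraction[OF assms] x y by simp_all
  ultimately show ?thesis by (simp add: min_def split: if_splits)
qed auto

lemma padic_val_sum_ge:
  assumes "prime p" "\<And>i. i \<in> A \<Longrightarrow> c \<le> padic_val p (f i)"
  shows "c \<le> padic_val p (sum f A)"
  using assms(2)
proof (induction A rule: infinite_finite_induct)
  case (insert i A)
  then have "c \<le> min (padic_val p (f i)) (padic_val p (sum f A))" by auto
  also have "\<dots> \<le> padic_val p (f i + sum f A)" by (rule padic_val_add_ge[OF assms(1)])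
  finally show ?case using insert by simp
qed auto

text \<open>The assumption \<open>c < \<infinity>\<close> handles an empty or infinite index set,
  where the sum is 0.\<close>

lemma padic_val_sum_gt:
  assumes "prime p" "c < \<infinity>" "\<And>i. i \<in> A \<Longrightarrow> c < padic_val p (f i)"
  shows "c < padic_val p (sum f A)"
  using assms(3)
proof (induction A rule: infinite_finite_induct)
  case (insert i A)
  then have "c < min (padic_val p (f i)) (padic_val p (sum f A))" by auto
  also have "\<dots> \<le> padic_val p (f i + sum f A)" by (rule padic_val_add_ge[OF assms(1)])
  finally show ?case using insert by simp
qed (use assms(2) in auto)

lemma padic_val_uminus [simp]:
  assumes "prime p"
  shows "padic_val p (- x) = padic_val p x"
proof (cases "x = 0")
  case False
  then obtain a b :: int where x: "x = of_int a / of_int b" "a \<noteq> 0" "b \<noteq> 0"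
    by (rule rat_fraction_cases)
  then have "- x = of_int (- a) / of_int b" by simp
  then show ?thesis
    using padic_val_fraction[OF assms, of "-a" b] padic_val_fraction[OF assms, of a b] x by simp
qed simp

lemma padic_val_add_eq:
  assumes "prime p" "padic_val p x < padic_val p y"
  shows "padic_val p (x + y) = padic_val p x"
proof (rule antisym)
  show "padic_val p x \<le> padic_val p (x + y)"
    using padic_val_add_ge[OF assms(1), of x y] assms(2) by (simp add: min_def split: if_splits)
  \<comment> \<open>Here \<open>x\<close> is read as \<open>(x + y) + (- y)\<close>. As
    \<open>y\<close> has the larger valuation, the minimum can only be attained by
    \<open>x + y\<close>.\<close>
  have "min (padic_val p (x + y)) (padic_val p (- y)) \<le> padic_val p x"
    using padic_val_add_ge[OF assms(1), of "x + y" "- y"] by simp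
  then show "padic_val p (x + y) \<le> padic_val p x"
    using assms by (simp add: min_def split: if_splits)
qed

section \<open>Coefficients of powers, compositions and iterates\<close>

lemma pcompose_sum_powers:
  fixes f g :: "'a :: comm_ring_1 poly"
  shows "f \<circ>\<^sub>p g = (\<Sum>i\<le>degree f. smult (coeff f i) (g ^ i))"
proof -
  have "(\<Sum>i\<le>degree f. smult (coeff f i) (g ^ i)) = poly (map_poly (\<lambda>x. [:x:]) f) g"
    by (subst poly_altdef) (simp add: degree_map_poly coeff_map_poly)
  then show ?thesis by (simp add: pcompose_altdef)
qed

text \<open>Linear lower bounds with a common slope multiply well: in each product of coefficients
  with indices \<open>i\<close> and \<open>k - i\<close> the intercepts add up and the indices sum
  to \<open>k\<close>. This is one half of the multiplicativity of a Gauss valuation.\<close>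

lemma padic_val_coeff_mult_ge:
  assumes "prime p"
    "\<And>k. ereal (a - s * real k) \<le> padic_val p (coeff A k)"
    "\<And>k. ereal (b - s * real k) \<le> padic_val p (coeff B k)"
  shows "ereal (a + b - s * real k) \<le> padic_val p (coeff (A * B) k)"
  unfolding coeff_mult
proof (rule padic_val_sum_ge[OF assms(1)])
  fix i assume "i \<in> {..k}"
  then have "ereal (a + b - s * real k) = ereal (a - s * real i) + ereal (b - s * real (k - i))"
    by (simp add: of_nat_diff algebra_simps)
  also have "\<dots> \<le> padic_val p (coeff A i) + padic_val p (coeff B (k - i))"
    by (intro add_mono assms)
  finally show "ereal (a + b - s * real k) \<le> padic_val p (coeff A i * coeff B (k - i))"
    by (simp add: padic_val_mult[OF assms(1)])
qed

lemma padic_val_coeff_power_ge: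
  assumes "prime p" "\<And>k. ereal (a - s * real k) \<le> padic_val p (coeff A k)" "0 \<le> s"
  shows "ereal (real i * a - s * real k) \<le> padic_val p (coeff (A ^ i) k)"
proof (induction i arbitrary: k)
  case 0
  show ?case using assms(3) by (cases k) (auto simp: coeff_1)
next
  case (Suc i)
  show ?case
    using padic_val_coeff_mult_ge[OF assms(1,2) Suc.IH, of k] by (simp add: algebra_simps)
qed

lemma poly_iterate_Suc: "poly_iterate f (Suc n) = f \<circ>\<^sub>p poly_iterate f n"
  by (simp add: poly_iterate_def)

lemma poly_iterate_0: "poly_iterate f 0 = [:0, 1:]"
  by (simp add: poly_iterate_def)

lemma degree_poly_iterate:
  fixes f :: "'a :: idom poly"
  shows "degree (poly_iterate f n) = degree f ^ n"
  by (induction n) (simp_all add: poly_iterate_0 poly_iterate_Suc degree_pcompose)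

lemma padic_val_lead_coeff_poly_iterate:
  assumes "prime p" "padic_val p (lead_coeff f) = 0" "degree f > 0"
  shows "padic_val p (lead_coeff (poly_iterate f n)) = 0"
proof (induction n)
  case (Suc n)
  have "degree (poly_iterate f n) > 0" using assms by (simp add: degree_poly_iterate)
  then have "lead_coeff (poly_iterate f (Suc n)) =
      lead_coeff f * lead_coeff (poly_iterate f n) ^ degree f"
    unfolding poly_iterate_Suc by (rule lead_coeff_comp)
  then show ?case
    using Suc assms by (simp only: padic_val_mult padic_val_power_eq_0) simp
qed (simp add: poly_iterate_0)

text \<open>Induction with \<open>f\<close> as the outer polynomial. In
  \<open>coeff f i * coeff (G ^ i) k\<close> the bound for \<open>f\<close> loses as
  \<open>i\<close> grows and the bound for the power gains; for \<open>k \<le> i * D\<close> the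
  gain prevails, and for larger \<open>k\<close> the power has no coefficient.\<close>

lemma padic_val_coeff_poly_iterate_ge:
  assumes "prime p" "degree f > 0" "0 \<le> u"
    and f: "\<And>i. ereal (u - u / real (degree f) * real i) \<le> padic_val p (coeff f i)"
  shows "ereal (u - u / real (degree f ^ n) * real k) \<le> padic_val p (coeff (poly_iterate f n) k)"
proof (induction n arbitrary: k)
  case 0
  show ?case using assms(3)
    by (cases "k = 0"; cases "k = 1") (auto simp: poly_iterate_0 coeff_pCons split: nat.splits)
next
  case (Suc n)
  define d where "d = degree f"
  define D where "D = degree f ^ n"
  define G where "G = poly_iterate f n"
  have d: "d \<ge> 1" and D: "D \<ge> 1" using assms(2) by (auto simp: d_def D_def)
  have G: "ereal (real i * u - u / real D * real k) \<le> padic_val p (coeff (G ^ i) k)" for i k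
    using padic_val_coeff_power_ge[OF assms(1) Suc.IH, of i k] assms(3) by (simp add: G_def D_def)
  have "ereal (u - u / real (d * D) * real k) \<le> padic_val p (coeff f i * coeff (G ^ i) k)" for i
  proof (cases "k \<le> i * D")
    case True
    have *: "u / real D * real k \<le> u * real i"
    proof -
      have "real k \<le> real i * real D" using True by (simp flip: of_nat_mult)
      then have "real k / real D \<le> real i" using D by (simp add: field_simps)
      then have "u * (real k / real D) \<le> u * real i" using assms(3) by (rule mult_left_mono)
      then show ?thesis by simp
    qed
    \<comment> \<open>Used with \<open>a = 1 / d\<close> and \<open>w = u / D\<close>: the surplus
      of the two known bounds over the claimed one is then a product of two nonnegative factors, the
      second by \<open>*\<close>.\<close>
    have expand: "(1 - a) * (u * real i - w * real k) =
        (u - a * u * real i) + (real i * u - w * real k) - (u - a * w * real k)" for a w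
      by (simp add: algebra_simps)
    have "0 \<le> (1 - 1 / real d) * (u * real i - u / real D * real k)"
      using d * by (intro mult_nonneg_nonneg) auto
    then have "u - u / real (d * D) * real k \<le>
        (u - u / real d * real i) + (real i * u - u / real D * real k)"
      unfolding expand by simp
    then have "ereal (u - u / real (d * D) * real k) \<le>
        ereal (u - u / real d * real i) + ereal (real i * u - u / real D * real k)" by simp
    also have "\<dots> \<le> padic_val p (coeff f i) + padic_val p (coeff (G ^ i) k)"
      using f G by (intro add_mono) (auto simp: d_def)
    finally show ?thesis by (simp add: padic_val_mult[OF assms(1)])
  next
    case False
    have "degree (G ^ i) \<le> D * i"
      using degree_power_le[of G i] by (simp add: G_def D_def degree_poly_iterate)
    then have "coeff (G ^ i) k = 0" using False by (intro coeff_eq_0) (simp add: mult.commute)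
    then show ?thesis by simp
  qed
  then have "ereal (u - u / real (d * D) * real k) \<le>
      padic_val p (\<Sum>i\<le>degree f. coeff f i * coeff (G ^ i) k)"
    by (intro padic_val_sum_ge[OF assms(1)])
  then show ?case
    by (simp add: poly_iterate_Suc pcompose_sum_powers coeff_sum G_def d_def D_def)
qed

section \<open>Newton polygons\<close>

text \<open>Separates the passage from hull to polygon from the polynomial, so that the convex
  geometry can be done for arbitrary planar sets.\<close>

definition lower_boundary :: "(real \<times> real) set \<Rightarrow> (real \<times> real) set" where
  "lower_boundary K = {(x, y). (x, y) \<in> K \<and> (\<forall>y'. (x, y') \<in> K \<longrightarrow> y \<le> y')}"

lemma newton_polygon_eq: "newton_polygon p h = lower_boundary (convex hull newton_points p h)"
  by (simp add: newton_polygon_def lower_boundary_def)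

lemma lower_boundaryI:
  assumes "(x, y) \<in> K" "\<And>y'. (x, y') \<in> K \<Longrightarrow> y \<le> y'"
  shows "(x, y) \<in> lower_boundary K"
  using assms by (simp add: lower_boundary_def)

lemma lower_boundary_mem: "v \<in> lower_boundary K \<Longrightarrow> v \<in> K"
  by (auto simp: lower_boundary_def)

lemma lower_boundary_le: "(x, y) \<in> lower_boundary K \<Longrightarrow> (x, y') \<in> K \<Longrightarrow> y \<le> y'"
  by (auto simp: lower_boundary_def)

text \<open>A vertical line meets a compact set in a compact set, on which the height attains its
  minimum.\<close>

lemma lower_boundary_below:
  assumes "compact K" "(x, y) \<in> K"
  obtains y0 where "y0 \<le> y" "(x, y0) \<in> lower_boundary K"
proof -
  have "compact (K \<inter> {x} \<times> UNIV)"
    using assms(1) by (intro compact_Int_closed closed_Times) auto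
  moreover have "K \<inter> {x} \<times> UNIV \<noteq> {}" using assms(2) by auto
  moreover have "continuous_on (K \<inter> {x} \<times> UNIV) snd" by (intro continuous_intros)
  ultimately obtain w where w: "w \<in> K \<inter> {x} \<times> UNIV" "\<And>z. z \<in> K \<inter> {x} \<times> UNIV \<Longrightarrow> snd w \<le> snd z"
    by (meson continuous_attains_inf)
  have "(x, snd w) \<in> lower_boundary K"
    using w by (intro lower_boundaryI) force+
  moreover have "snd w \<le> y" using w(2)[of "(x, y)"] assms(2) by auto
  ultimately show ?thesis by (rule that[rotated])
qed

text \<open>Suppose \<open>v\<close> is inside a segment of \<open>K\<close>. A vertical segment
  contradicts minimality of the height. Otherwise the boundary runs below the segment on both sides
  of \<open>v\<close>, so a change of slope there would be concave, and a chord of the boundary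
  would pass below \<open>v\<close>.\<close>

lemma polygon_vertex_extreme_point:
  fixes v :: "real \<times> real"
  assumes "convex K" "compact K" "v \<in> lower_boundary K"
    and "(\<forall>w\<in>lower_boundary K. fst v \<le> fst w) \<or> (\<forall>w\<in>lower_boundary K. fst w \<le> fst v) \<or>
      slope_changes_at (lower_boundary K) v"
  shows "v extreme_point_of K"
proof -
  obtain x y where v: "v = (x, y)" by force
  have *: False if ab: "a \<in> K" "b \<in> K" "v \<in> open_segment a b" "fst a \<le> fst b" for a b
  proof -
    obtain t where t: "0 < t" "t < 1" and vt: "v = (1 - t) *\<^sub>R a + t *\<^sub>R b" and "a \<noteq> b"
      using ab(3) by (auto simp: in_segment)
    obtain a1 a2 b1 b2 where a: "a = (a1, a2)" and b: "b = (b1, b2)" by force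
    have x: "x = (1 - t) * a1 + t * b1" and y: "y = (1 - t) * a2 + t * b2"
      using vt by (simp_all add: v a b)
    show False
    proof (cases "a1 = b1")
      case True
      then have "x = a1" using x by (simp add: algebra_simps)
      then have "y \<le> a2" "y \<le> b2"
        using lower_boundary_le[of x y K] assms(3) ab True by (auto simp: v a b)
      moreover have "(1 - t) * (a2 - y) + t * (b2 - y) = 0" using y by (simp add: algebra_simps)
      ultimately have "(1 - t) * (a2 - y) = 0" "t * (b2 - y) = 0"
        using t by (smt (verit) mult_nonneg_nonneg)+
      then show False using t True \<open>a \<noteq> b\<close> by (simp add: a b)
    next
      case False
      then have lt: "a1 < b1" using ab by (simp add: a b)
      have x1: "x - a1 = t * (b1 - a1)" "b1 - x = (1 - t) * (b1 - a1)"
        using x by (simp_all add: algebra_simps)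
      then have a1x: "a1 < x" "x < b1" using lt t by (smt (verit) mult_pos_pos)+
      \<comment> \<open>Boundary points strictly to the left and right of \<open>v\<close> exclude
        the two cases of an endpoint.\<close>
      obtain a2' b2' where "(a1, a2') \<in> lower_boundary K" "(b1, b2') \<in> lower_boundary K"
        using lower_boundary_below[OF assms(2)] ab a b by metis
      then have "slope_changes_at (lower_boundary K) v"
        using assms(4) a1x by (force simp: v)
      then obtain s1 s2 \<epsilon> where s: "s1 \<noteq> s2" "\<epsilon> > 0"
        "\<And>r. r \<in> {0..\<epsilon>} \<Longrightarrow> (x - r, y - s1 * r) \<in> lower_boundary K \<and> (x + r, y + s2 * r) \<in> lower_boundary K"
        unfolding slope_changes_at_def by (auto simp: v)
      define \<sigma> where "\<sigma> = (b2 - a2) / (b1 - a1)"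
      have on_line: "(x + r, y + \<sigma> * r) \<in> K" if "a1 \<le> x + r" "x + r \<le> b1" for r
      proof -
        define q where "q = (x + r - a1) / (b1 - a1)"
        have q: "0 \<le> q" "q \<le> 1" using that lt by (auto simp: q_def)
        have "r = (q - t) * (b1 - a1)" using lt x1 by (simp add: q_def field_simps)
        then have "\<sigma> * r = (q - t) * (b2 - a2)" using lt by (simp add: \<sigma>_def)
        then have "y + \<sigma> * r = (1 - q) * a2 + q * b2" using y by (simp add: algebra_simps)
        moreover have "x + r = (1 - q) * a1 + q * b1"
          using \<open>r = _\<close> x by (simp add: algebra_simps)
        ultimately have "(x + r, y + \<sigma> * r) = (1 - q) *\<^sub>R a + q *\<^sub>R b"
          by (simp add: a b)
        then show ?thesis using assms(1) ab q by (simp add: convex_alt)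
      qed
      define r where "r = min \<epsilon> (min (x - a1) (b1 - x))"
      have r: "0 < r" "r \<le> \<epsilon>" "r \<le> x - a1" "r \<le> b1 - x" using s(2) a1x by (auto simp: r_def)
      have L: "(x - r, y - s1 * r) \<in> lower_boundary K" "(x + r, y + s2 * r) \<in> lower_boundary K"
        using s(3)[of r] r by auto
      have "y + s2 * r \<le> y + \<sigma> * r"
        using lower_boundary_le[OF L(2) on_line] r a1x by simp
      moreover have "y - s1 * r \<le> y + \<sigma> * (- r)"
        using lower_boundary_le[OF L(1), of "y + \<sigma> * (- r)"] on_line[of "- r"] r a1x by simp
      ultimately have "s2 * r \<le> \<sigma> * r" "\<sigma> * r \<le> s1 * r" by auto
      then have "s2 \<le> \<sigma>" "\<sigma> \<le> s1" using r(1) by auto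
      then have "s2 < s1" using s(1) by auto
      \<comment> \<open>The midpoint of the two boundary points lies over \<open>x\<close>, at a
        height below \<open>y\<close> because \<open>s2 < s1\<close>.\<close>
      have "(1/2) *\<^sub>R (x - r, y - s1 * r) + (1/2) *\<^sub>R (x + r, y + s2 * r) \<in> K"
        using L[THEN lower_boundary_mem] by (intro convexD[OF assms(1)]) auto
      then have "(x, y + (s2 - s1) * r / 2) \<in> K" by (simp add: algebra_simps add_divide_distrib diff_divide_distrib)
      then have "y \<le> y + (s2 - s1) * r / 2"
        using lower_boundary_le assms(3) by (metis v)
      then show False using \<open>s2 < s1\<close> r(1) by (simp add: field_simps)
    qed
  qed
  show ?thesis
    unfolding extreme_point_of_def
    using * lower_boundary_mem[OF assms(3)] open_segment_commute
    by (metis linorder_linear)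
qed

lemma convex_above_line: "convex {z::real\<times>real. y + s * (fst z - x) \<le> snd z}"
proof -
  have "{z::real\<times>real. y + s * (fst z - x) \<le> snd z} = {z. inner (s, -1) z \<le> s * x - y}"
    by (auto simp: inner_prod_def algebra_simps)
  then show ?thesis by (simp add: convex_halfspace_le)
qed

lemma supporting_segment_subset_lower_boundary:
  assumes "v \<in> P" "w \<in> P" "\<And>z. z \<in> P \<Longrightarrow> snd v + s * (fst z - fst v) \<le> snd z"
    and "snd w = snd v + s * (fst w - fst v)" "0 \<le> q" "q \<le> 1"
  shows "(fst v + q * (fst w - fst v), snd v + s * (q * (fst w - fst v)))
    \<in> lower_boundary (convex hull P)"
proof (rule lower_boundaryI)
  have "(1 - q) *\<^sub>R v + q *\<^sub>R w \<in> convex hull P"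
    using assms hull_inc[of _ P convex] convex_convex_hull[of P] by (simp add: convex_alt)
  moreover have "(1 - q) *\<^sub>R v + q *\<^sub>R w =
      (fst v + q * (fst w - fst v), snd v + s * (q * (fst w - fst v)))"
    by (simp add: prod_eq_iff assms(4) algebra_simps)
  ultimately show "(fst v + q * (fst w - fst v), snd v + s * (q * (fst w - fst v))) \<in> convex hull P"
    by simp
next
  fix y' assume "(fst v + q * (fst w - fst v), y') \<in> convex hull P"
  moreover have "convex hull P \<subseteq> {z. snd v + s * (fst z - fst v) \<le> snd z}"
    using assms(3) by (intro hull_minimal convex_above_line) auto
  ultimately show "snd v + s * (q * (fst w - fst v)) \<le> y'" by auto
qed

text \<open>The edges at \<open>v\<close> lead to a point of \<open>P\<close> on the left with
  maximal slope and to one on the right with minimal slope. Extremality makes these slopes differ,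
  and the two edge lines then support \<open>P\<close> from below.\<close>

lemma extreme_point_slope_changes_at:
  fixes v :: "real \<times> real"
  assumes "finite P" "v \<in> lower_boundary (convex hull P)" "v extreme_point_of (convex hull P)"
    and l: "l \<in> P" "fst l < fst v" and r: "r \<in> P" "fst v < fst r"
  shows "slope_changes_at (lower_boundary (convex hull P)) v"
proof -
  let ?K = "convex hull P"
  obtain x y where v: "v = (x, y)" by force
  have vP: "v \<in> P" using assms(3) by (rule extreme_point_of_convex_hull)
  define slope where "slope = (\<lambda>z::real\<times>real. (snd z - y) / (fst z - x))"
  obtain w1 where w1: "w1 \<in> P" "fst w1 < x" and
    s1_max: "\<And>z. z \<in> P \<Longrightarrow> fst z < x \<Longrightarrow> slope z \<le> slope w1"
  proof -
    let ?S = "{z \<in> P. fst z < x}"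
    have "l \<in> ?S" using l v by simp
    then have S: "finite (slope ` ?S)" "slope ` ?S \<noteq> {}" using assms(1) by (simp, blast)
    obtain w where "w \<in> ?S" "Max (slope ` ?S) = slope w" using Max_in[OF S] by blast
    then show ?thesis using that[of w] Max_ge[OF S(1)] by fastforce
  qed
  obtain w2 where w2: "w2 \<in> P" "x < fst w2" and
    s2_min: "\<And>z. z \<in> P \<Longrightarrow> x < fst z \<Longrightarrow> slope w2 \<le> slope z"
  proof -
    let ?S = "{z \<in> P. x < fst z}"
    have "r \<in> ?S" using r v by simp
    then have S: "finite (slope ` ?S)" "slope ` ?S \<noteq> {}" using assms(1) by (simp, blast)
    obtain w where "w \<in> ?S" "Min (slope ` ?S) = slope w" using Min_in[OF S] by blast
    then show ?thesis using that[of w] Min_le[OF S(1)] by fastforce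
  qed
  define s1 s2 where "s1 = slope w1" and "s2 = slope w2"
  have w1y: "snd w1 = y + s1 * (fst w1 - x)" and w2y: "snd w2 = y + s2 * (fst w2 - x)"
    using w1 w2 by (simp_all add: s1_def s2_def slope_def)
  \<comment> \<open>The weight for which the chord from \<open>w1\<close> to \<open>w2\<close>
    passes over \<open>x\<close>. Its height above \<open>v\<close> has the sign of
    \<open>s2 - s1\<close>, and height zero would put \<open>v\<close> inside the chord.\<close>
  define q where "q = (x - fst w1) / (fst w2 - fst w1)"
  have q: "0 < q" "q < 1" using w1 w2 by (auto simp: q_def)
  have qx: "(1 - q) * fst w1 + q * fst w2 = x"
  proof -
    have "q * (fst w2 - fst w1) = x - fst w1" using w1 w2 by (simp add: q_def)
    then show ?thesis by (simp add: algebra_simps)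
  qed
  have mid: "(1 - q) *\<^sub>R w1 + q *\<^sub>R w2 = (x, (1 - q) * snd w1 + q * snd w2)"
    using qx by (simp add: prod_eq_iff)
  have midK: "(1 - q) *\<^sub>R w1 + q *\<^sub>R w2 \<in> ?K"
    using w1 w2 q hull_inc[of _ P convex] convex_convex_hull[of P] by (simp add: convex_alt)
  have height: "(1 - q) * snd w1 + q * snd w2 - y = (s2 - s1) * (q * (fst w2 - x))"
  proof -
    have balance: "(1 - q) * (fst w1 - x) = - (q * (fst w2 - x))"
      using qx by (simp add: algebra_simps)
    have "(1 - q) * snd w1 + q * snd w2 - y =
        s1 * ((1 - q) * (fst w1 - x)) + s2 * (q * (fst w2 - x))"
      by (simp add: w1y w2y algebra_simps)
    then show ?thesis unfolding balance by (simp add: left_diff_distrib)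
  qed
  have pos: "q * (fst w2 - x) > 0" using q w2 by simp
  have "y \<le> (1 - q) * snd w1 + q * snd w2"
    using lower_boundary_le assms(2) midK mid v by metis
  then have "s1 \<le> s2" using height pos by (smt (verit) mult_neg_pos)
  moreover have "s1 \<noteq> s2"
  proof
    assume "s1 = s2"
    then have "v = (1 - q) *\<^sub>R w1 + q *\<^sub>R w2" using mid height v by simp
    moreover have "w1 \<noteq> w2" using w1 w2 by auto
    ultimately have "v \<in> open_segment w1 w2" using q by (auto simp: in_segment)
    then show False using assms(3) w1 w2 hull_inc[of _ P convex]
      unfolding extreme_point_of_def by blast
  qed
  ultimately have s12: "s1 < s2" by simp
  \<comment> \<open>On each side one line is handled by the extremal choice of the slope; the other
    line is even lower there since \<open>s1 < s2\<close>.\<close>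
  have above: "y + s1 * (fst z - x) \<le> snd z \<and> y + s2 * (fst z - x) \<le> snd z" if z: "z \<in> P" for z
  proof -
    consider "fst z < x" | "fst z = x" | "x < fst z" by linarith
    then show ?thesis
    proof cases
      case 1
      have "slope z \<le> s1" using s1_max z 1 by (simp add: s1_def)
      then have "s1 * (fst z - x) \<le> slope z * (fst z - x)" "s2 * (fst z - x) \<le> slope z * (fst z - x)"
        using 1 s12 by (auto intro: mult_right_mono_neg)
      then show ?thesis using 1 by (simp add: slope_def)
    next
      case 2
      have "(x, snd z) \<in> ?K" using z 2 hull_inc[of z P convex] by (metis prod.collapse)
      then have "y \<le> snd z" using lower_boundary_le assms(2) v by metis
      then show ?thesis using 2 by simp
    next
      case 3
      have "s2 \<le> slope z" using s2_min z 3 by (simp add: s2_def)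
      then have "s1 * (fst z - x) \<le> slope z * (fst z - x)" "s2 * (fst z - x) \<le> slope z * (fst z - x)"
        using 3 s12 by (auto intro: mult_right_mono)
      then show ?thesis using 3 by (simp add: slope_def)
    qed
  qed
  define \<epsilon> where "\<epsilon> = min (x - fst w1) (fst w2 - x)"
  have "(x - t, y - s1 * t) \<in> lower_boundary ?K \<and> (x + t, y + s2 * t) \<in> lower_boundary ?K"
    if t: "t \<in> {0..\<epsilon>}" for t
  proof
    have "0 \<le> t / (x - fst w1)" "t / (x - fst w1) \<le> 1" using t w1 by (auto simp: \<epsilon>_def)
    moreover have "t / (x - fst w1) * (fst w1 - x) = - t" using w1(2) by (simp add: field_simps)
    ultimately show "(x - t, y - s1 * t) \<in> lower_boundary ?K"
      using supporting_segment_subset_lower_boundary[OF vP w1(1), of s1 "t / (x - fst w1)"]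
        above w1y by (simp add: v)
    have "0 \<le> t / (fst w2 - x)" "t / (fst w2 - x) \<le> 1" using t w2 by (auto simp: \<epsilon>_def)
    from supporting_segment_subset_lower_boundary[OF vP w2(1) _ _ this, of s2]
    show "(x + t, y + s2 * t) \<in> lower_boundary ?K"
      using above w2y w2(2) by (simp add: v)
  qed
  moreover have "\<epsilon> > 0" using w1 w2 by (simp add: \<epsilon>_def)
  ultimately show ?thesis
    using \<open>s1 \<noteq> s2\<close> unfolding slope_changes_at_def v fst_conv snd_conv by blast
qed

text \<open>By Krein-Milman, \<open>v\<close> is a convex combination of extreme points. If one with
  positive weight were off the lower boundary, replacing it by a lower point of the hull on the same
  vertical would give a point of the hull directly below \<open>v\<close>.\<close>

lemma lower_boundary_subset_hull_extreme_points:
  assumes "finite P"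
  shows "lower_boundary (convex hull P) \<subseteq>
    convex hull {v \<in> lower_boundary (convex hull P). v extreme_point_of (convex hull P)}"
proof
  let ?K = "convex hull P"
  define E where "E = {v. v extreme_point_of ?K}"
  have EP: "E \<subseteq> P" by (auto simp: E_def extreme_point_of_convex_hull)
  have K: "?K = convex hull E"
    unfolding E_def using assms by (intro Krein_Milman_polytope)
  have fin: "finite E" using EP assms finite_subset by blast
  fix v assume v: "v \<in> lower_boundary ?K"
  have "v \<in> convex hull E" using lower_boundary_mem[OF v] by (simp only: K[symmetric])
  then have "\<exists>c. (\<forall>z\<in>E. 0 \<le> c z) \<and> sum c E = 1 \<and> (\<Sum>z\<in>E. c z *\<^sub>R z) = v"
    by (simp add: convex_hull_finite[OF fin])
  then obtain c where c: "\<And>z. z \<in> E \<Longrightarrow> 0 \<le> c z" "sum c E = 1" "(\<Sum>z\<in>E. c z *\<^sub>R z) = v"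
    by blast
  have supp: "z \<in> lower_boundary ?K" if z: "z \<in> E" "c z \<noteq> 0" for z
  proof (rule ccontr)
    assume not_lower: "z \<notin> lower_boundary ?K"
    have EK: "i \<in> ?K" if "i \<in> E" for i using EP that by (intro hull_inc) blast
    obtain y' where y': "(fst z, y') \<in> ?K" "y' < snd z"
    proof (rule ccontr)
      assume "\<not> thesis"
      with that have "snd z \<le> y'" if "(fst z, y') \<in> ?K" for y' using \<open>(fst z, y') \<in> ?K\<close> not_le by blast
      then have "(fst z, snd z) \<in> lower_boundary ?K"
        using EK[OF z(1)] by (intro lower_boundaryI) simp_all
      then show False using not_lower by simp
    qed
    have cz: "c z > 0" using c(1)[OF z(1)] z(2) by simp
    have "(\<Sum>i\<in>E. c i *\<^sub>R (if i = z then (fst z, y') else i)) \<in> ?K"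
      using c(1,2) y'(1) EK by (intro convex_sum fin convex_convex_hull) simp_all
    also have "(\<Sum>i\<in>E. c i *\<^sub>R (if i = z then (fst z, y') else i)) =
        (\<Sum>i\<in>E. c i *\<^sub>R i + (if i = z then (0, c z * (y' - snd z)) else 0))"
      by (intro sum.cong) (auto simp: prod_eq_iff algebra_simps)
    also have "\<dots> = v + (0, c z * (y' - snd z))"
      using z(1) fin by (simp add: sum.distrib c(3))
    finally have "(fst v, snd v + c z * (y' - snd z)) \<in> ?K" by (simp add: prod_eq_iff plus_prod_def)
    then have "snd v \<le> snd v + c z * (y' - snd z)"
      using v by (intro lower_boundary_le[of "fst v" _ ?K]) simp_all
    then show False using mult_pos_neg[OF cz, of "y' - snd z"] y'(2) by simp
  qed
  let ?E' = "{v \<in> lower_boundary ?K. v extreme_point_of ?K}"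
  have sub: "?E' \<subseteq> E" by (auto simp: E_def)
  have z0: "c z = 0" if "z \<in> E - ?E'" for z
    using supp[of z] that by (auto simp: E_def simp del: split_paired_All)
  have "v = (\<Sum>z\<in>?E'. c z *\<^sub>R z)"
    unfolding c(3)[symmetric] using z0 by (intro sum.mono_neutral_right fin sub) auto
  moreover have "sum c ?E' = 1"
    unfolding c(2)[symmetric] using z0 by (intro sum.mono_neutral_left fin sub) auto
  moreover have "finite ?E'" using sub fin finite_subset by blast
  ultimately show "v \<in> convex hull ?E'"
    using c(1) sub unfolding convex_hull_finite[OF \<open>finite ?E'\<close>] by blast
qed

lemma finite_newton_points: "finite (newton_points p h)"
proof (rule finite_subset)
  show "newton_points p h \<subseteq>
      (\<lambda>i. (real (degree h) - real i, real_of_ereal (padic_val p (coeff h i)))) ` {..degree h}"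
    unfolding newton_points_def
    by (auto simp: image_iff) (metis atMost_iff real_of_ereal.simps(1))
qed simp

text \<open>Identifying the vertices with extreme points makes the Krein-Milman theorem available: the
  polygon lies in the convex hull of its vertices.\<close>

lemma newton_vertices_eq:
  "newton_vertices p h =
    {v \<in> newton_polygon p h. v extreme_point_of (convex hull newton_points p h)}"
proof -
  let ?P = "newton_points p h"
  let ?L = "lower_boundary (convex hull ?P)"
  have comp: "compact (convex hull ?P)"
    by (intro compact_convex_hull finite_imp_compact finite_newton_points)
  have "(\<forall>w\<in>?L. fst v \<le> fst w) \<or> (\<forall>w\<in>?L. fst w \<le> fst v) \<or> slope_changes_at ?L v"
    if v: "v \<in> ?L" "v extreme_point_of (convex hull ?P)" for v
  proof (rule ccontr)
    assume *: "\<not> ?thesis"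
    \<comment> \<open>Without points of \<open>?P\<close> on one side, the whole hull would lie in a
      half-plane bounded by the vertical through \<open>v\<close>, making \<open>v\<close> an
      endpoint of the polygon.\<close>
    have "\<exists>l\<in>?P. fst l < fst v"
    proof (rule ccontr)
      assume "\<not> (\<exists>l\<in>?P. fst l < fst v)"
      then have "convex hull ?P \<subseteq> {fst v..} \<times> UNIV"
        by (intro hull_minimal convex_Times) (auto simp: not_less)
      then show False using * lower_boundary_mem by fastforce
    qed
    moreover have "\<exists>r\<in>?P. fst v < fst r"
    proof (rule ccontr)
      assume "\<not> (\<exists>r\<in>?P. fst v < fst r)"
      then have "convex hull ?P \<subseteq> {..fst v} \<times> UNIV"
        by (intro hull_minimal convex_Times) (auto simp: not_less)
      then show False using * lower_boundary_mem by fastforce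
    qed
    ultimately show False
      using extreme_point_slope_changes_at[OF finite_newton_points v] * by blast
  qed
  then show ?thesis
    using polygon_vertex_extreme_point[OF convex_convex_hull comp]
    unfolding newton_vertices_def newton_polygon_eq by blast
qed

lemma newton_vertices_subset_points: "newton_vertices p h \<subseteq> newton_points p h"
  by (auto simp: newton_vertices_eq extreme_point_of_convex_hull)

lemma newton_polygon_subset_hull_vertices:
  "newton_polygon p h \<subseteq> convex hull newton_vertices p h"
  unfolding newton_vertices_eq newton_polygon_eq
  by (intro lower_boundary_subset_hull_extreme_points finite_newton_points)

section \<open>Horizontal stretching of Newton polygons\<close>

definition stretch :: "real \<Rightarrow> real \<times> real \<Rightarrow> real \<times> real" where
  "stretch c v = (c * fst v, snd v)"

lemma linear_stretch: "linear (stretch c)"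
  by (rule linearI) (auto simp: stretch_def algebra_simps)

lemma slope_changes_at_stretch:
  assumes "c > 0" "slope_changes_at C v"
  shows "slope_changes_at (stretch c ` C) (stretch c v)"
proof -
  obtain s1 s2 \<epsilon> where s: "s1 \<noteq> s2" "\<epsilon> > 0"
    "\<And>r. r \<in> {0..\<epsilon>} \<Longrightarrow> (fst v - r, snd v - s1 * r) \<in> C \<and> (fst v + r, snd v + s2 * r) \<in> C"
    using assms(2) unfolding slope_changes_at_def by blast
  have "(c * fst v - r, snd v - s1 / c * r) \<in> stretch c ` C \<and>
      (c * fst v + r, snd v + s2 / c * r) \<in> stretch c ` C" if "r \<in> {0..c * \<epsilon>}" for r
  proof -
    have "r / c \<in> {0..\<epsilon>}" using that assms(1) by (auto simp: field_simps)
    from s(3)[OF this] have "stretch c (fst v - r / c, snd v - s1 * (r / c)) \<in> stretch c ` C"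
      "stretch c (fst v + r / c, snd v + s2 * (r / c)) \<in> stretch c ` C" by blast+
    then show ?thesis using assms(1) by (simp add: stretch_def right_diff_distrib distrib_left)
  qed
  moreover have "s1 / c \<noteq> s2 / c" "c * \<epsilon> > 0" using s assms(1) by auto
  ultimately show ?thesis
    unfolding slope_changes_at_def
    by (intro exI[of _ "s1 / c"] exI[of _ "s2 / c"] exI[of _ "c * \<epsilon>"]) (auto simp: stretch_def)
qed

lemma slope_changes_at_stretch_iff:
  assumes "c > 0"
  shows "slope_changes_at (stretch c ` C) (stretch c v) \<longleftrightarrow> slope_changes_at C v"
proof
  have inv: "stretch (1 / c) (stretch c w) = w" for w using assms by (simp add: stretch_def)
  assume "slope_changes_at (stretch c ` C) (stretch c v)"
  from slope_changes_at_stretch[OF _ this, of "1 / c"] show "slope_changes_at C v"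
    using assms by (simp add: image_image inv)
qed (rule slope_changes_at_stretch[OF assms])

text \<open>The vertices are determined by the polygon as a planar set, and both the order of
  abscissae and changes of slope survive a stretch by \<open>c > 0\<close>.\<close>

lemma newton_vertices_stretch:
  assumes "c > 0" "newton_polygon p h = stretch c ` newton_polygon p g"
  shows "newton_vertices p h = stretch c ` newton_vertices p g"
proof -
  have le: "fst (stretch c v) \<le> fst (stretch c w) \<longleftrightarrow> fst v \<le> fst w" for v w
    using assms(1) by (simp add: stretch_def)
  show ?thesis
    unfolding newton_vertices_def assms(2)
    by (auto simp only: ball_simps le slope_changes_at_stretch_iff[OF assms(1)])
qed

text \<open>A sandwich: the first assumption places the stretched polygon of \<open>g\<close> inside
  the hull of \<open>h\<close>, the second places the hull of \<open>h\<close> on or above that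
  polygon. So the two lower boundaries agree.\<close>

lemma newton_polygon_stretch:
  assumes "stretch c ` newton_vertices p g \<subseteq> newton_points p h"
    and "\<And>x y. (x, y) \<in> newton_points p h \<Longrightarrow>
      \<exists>y'\<le>y. (x, y') \<in> stretch c ` (convex hull newton_points p g)" and "c > 0"
  shows "newton_polygon p h = stretch c ` newton_polygon p g"
proof -
  define A where "A = convex hull newton_points p g"
  define B where "B = convex hull newton_points p h"
  have comp: "compact A"
    unfolding A_def by (intro compact_convex_hull finite_imp_compact finite_newton_points)
  have conv: "convex (stretch c ` A)"
    unfolding A_def by (intro convex_linear_image linear_stretch convex_convex_hull)
  have B_sub: "B \<subseteq> {(x, y). \<exists>y'\<le>y. (x, y') \<in> stretch c ` A}"
    unfolding B_def
  proof (rule hull_minimal)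
    show "newton_points p h \<subseteq> {(x, y). \<exists>y'\<le>y. (x, y') \<in> stretch c ` A}"
      using assms(2) by (auto simp: A_def)
    \<comment> \<open>The region above the stretched hull is its Minkowski sum with a vertical ray,
      hence convex.\<close>
    have "{(x, y). \<exists>y'\<le>y. (x, y') \<in> stretch c ` A} =
        (\<Union>z\<in>stretch c ` A. \<Union>w\<in>{0} \<times> {0..}. {z + w})" (is "?U = ?S")
    proof (intro equalityI subsetI)
      fix v assume "v \<in> ?U"
      then obtain y' where "y' \<le> snd v" "(fst v, y') \<in> stretch c ` A" by auto
      moreover have "v = (fst v, y') + (0, snd v - y')" by (simp add: prod_eq_iff)
      ultimately show "v \<in> ?S" by (intro UN_I[of "(fst v, y')"] UN_I[of "(0, snd v - y')"]) auto
    next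
      fix v assume "v \<in> ?S"
      then obtain z w where zw: "z \<in> stretch c ` A" "w \<in> {0} \<times> {0..}" "v = z + w" by blast
      then have "snd z \<le> snd v" "fst v = fst z" by auto
      then have "\<exists>y'\<le>snd v. (fst v, y') \<in> stretch c ` A"
        using zw(1) by (metis prod.collapse)
      then show "v \<in> ?U" by (simp add: case_prod_beta)
    qed
    then show "convex {(x, y). \<exists>y'\<le>y. (x, y') \<in> stretch c ` A}"
      using convex_sums[OF conv, of "{0} \<times> {0..}"] by (simp add: convex_Times)
  qed
  then have B_above: "\<exists>y'\<le>y. (x, y') \<in> stretch c ` lower_boundary A" if "(x, y) \<in> B" for x y
  proof -
    have "\<exists>y'\<le>y. (x, y') \<in> stretch c ` A" using subsetD[OF B_sub that] by simp
    then obtain y' w where w: "y' \<le> y" "w \<in> A" "(x, y') = stretch c w" by blast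
    then have "x = c * fst w" "y' = snd w" by (simp_all add: stretch_def)
    moreover obtain y0 where "y0 \<le> snd w" "(fst w, y0) \<in> lower_boundary A"
      using lower_boundary_below[OF comp, of "fst w" "snd w"] w(2) by auto
    moreover from this(2) have "stretch c (fst w, y0) \<in> stretch c ` lower_boundary A"
      by (rule imageI)
    ultimately show ?thesis using w(1) by (intro exI[of _ y0]) (simp add: stretch_def)
  qed
  have "stretch c ` lower_boundary A \<subseteq> stretch c ` (convex hull newton_vertices p g)"
    using newton_polygon_subset_hull_vertices unfolding newton_polygon_eq A_def by blast
  also have "\<dots> = convex hull (stretch c ` newton_vertices p g)"
    by (rule convex_hull_linear_image[OF linear_stretch])
  also have "\<dots> \<subseteq> B" unfolding B_def by (rule hull_mono[OF assms(1)])
  finally have sub: "stretch c ` lower_boundary A \<subseteq> B" .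
  have single: "y = y'"
    if xy: "(x, y) \<in> stretch c ` lower_boundary A" "(x, y') \<in> stretch c ` lower_boundary A" for x y y'
  proof -
    obtain x1 where "(x1, y) \<in> lower_boundary A" "(x1, y') \<in> lower_boundary A"
      using xy assms(3) by (auto simp: stretch_def)
    then show ?thesis by (meson antisym lower_boundary_le lower_boundary_mem)
  qed
  have "lower_boundary B = stretch c ` lower_boundary A"
  proof (intro equalityI subsetI)
    fix v assume v: "v \<in> lower_boundary B"
    obtain x y where xy: "v = (x, y)" by force
    obtain y' where y': "y' \<le> y" "(x, y') \<in> stretch c ` lower_boundary A"
      using B_above[of x y] lower_boundary_mem[OF v] xy by auto
    then have "(x, y') \<in> B" using sub by blast
    then have "y \<le> y'" using v unfolding xy by (intro lower_boundary_le)
    with y' have "y = y'" by simp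
    with y'(2) show "v \<in> stretch c ` lower_boundary A" by (simp only: xy)
  next
    fix v assume v: "v \<in> stretch c ` lower_boundary A"
    obtain x y where xy: "v = (x, y)" by (cases v)
    show "v \<in> lower_boundary B"
      unfolding xy
    proof (rule lower_boundaryI)
      show "(x, y) \<in> B" using subsetD[OF sub v] by (simp only: xy)
      fix y' assume "(x, y') \<in> B"
      then obtain y'' where "y'' \<le> y'" "(x, y'') \<in> stretch c ` lower_boundary A"
        using B_above by blast
      moreover from this(2) have "y = y''" using v unfolding xy by (intro single)
      ultimately show "y \<le> y'" by simp
    qed
  qed
  then show ?thesis by (simp add: newton_polygon_eq A_def B_def)
qed

section \<open>Composition\<close>

lemma newton_pointsI:
  "i \<le> degree h \<Longrightarrow> ereal y = padic_val p (coeff h i) \<Longrightarrow>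
    (real (degree h) - real i, y) \<in> newton_points p h"
  by (auto simp: newton_points_def)

text \<open>The slope condition enters through a single line: all vertices of \<open>g\<close> lie
  on or above the line of slope \<open>s < u\<close> through the last point \<open>(e, b0)\<close>.
  Hence a chord from any hull point further left to that last point has slope below
  \<open>u\<close>, which keeps the lower terms of each summand above the polygon.\<close>

lemma newton_vertices_pcompose:
  fixes g F :: "rat poly" and b0 s u :: real
  assumes "prime p" "coeff g 0 \<noteq> 0" "degree F > 0" "0 \<le> u"
    and lead: "padic_val p (lead_coeff F) = 0"
    and F: "\<And>k. ereal (u - u / real (degree F) * real k) \<le> padic_val p (coeff F k)"
    and b0: "ereal b0 = padic_val p (coeff g 0)" and "s < u"
    and vertices: "\<And>x y. (x, y) \<in> newton_vertices p g \<Longrightarrow> b0 + s * (x - real (degree g)) \<le> y"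
  shows "newton_vertices p (g \<circ>\<^sub>p F) = stretch (real (degree F)) ` newton_vertices p g"
proof (rule newton_vertices_stretch)
  define e D where "e = degree g" and "D = degree F"
  define K where "K = convex hull newton_points p g"
  define tm where "tm = (\<lambda>j k. coeff g j * coeff (F ^ j) k)"
  have D: "D > 0" using assms(3) by (simp add: D_def)
  have deg: "degree (g \<circ>\<^sub>p F) = e * D" by (simp add: degree_pcompose e_def D_def)
  have coeff_h: "coeff (g \<circ>\<^sub>p F) k = (\<Sum>j\<le>e. tm j k)" for k
    by (simp add: pcompose_sum_powers coeff_sum tm_def e_def)
  have comp: "compact K"
    unfolding K_def by (intro compact_convex_hull finite_imp_compact finite_newton_points)
  have point: "(real e - real j, y) \<in> K" if "j \<le> e" "ereal y = padic_val p (coeff g j)" for j y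
    unfolding K_def e_def using that by (intro hull_inc newton_pointsI) (simp_all add: e_def)
  have last: "(real e, b0) \<in> K" using point[of 0 b0] b0 by simp
  have above: "b0 + s * (x - real e) \<le> y" if xy: "(x, y) \<in> K" for x y
  proof -
    obtain y0 where y0: "y0 \<le> y" "(x, y0) \<in> lower_boundary K"
      using lower_boundary_below[OF comp xy] .
    have "newton_vertices p g \<subseteq> {z. b0 + s * (fst z - real e) \<le> snd z}"
      using vertices by (auto simp: e_def)
    then have "convex hull newton_vertices p g \<subseteq> {z. b0 + s * (fst z - real e) \<le> snd z}"
      by (intro hull_minimal convex_above_line)
    moreover have "(x, y0) \<in> convex hull newton_vertices p g"
      using y0(2) newton_polygon_subset_hull_vertices by (auto simp: newton_polygon_eq K_def)
    ultimately show ?thesis using y0(1) by auto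
  qed
  \<comment> \<open>The witness is the point over \<open>x'\<close> on the chord from
    \<open>(x, y)\<close> to \<open>(e, b0)\<close>; \<open>q\<close> is the fraction of the chord
    covered.\<close>
  have ascend: "\<exists>y'. (x', y') \<in> K \<and> y' < y + u * (x' - x)"
    if "(x, y) \<in> K" "x < x'" "x' \<le> real e" for x y x'
  proof -
    define q where "q = (x' - x) / (real e - x)"
    have q: "0 \<le> q" "q \<le> 1" and qx: "q * (real e - x) = x' - x"
      using that by (auto simp: q_def)
    have "(1 - q) *\<^sub>R (x, y) + q *\<^sub>R (real e, b0) \<in> K"
      unfolding K_def using that(1) last q
      by (intro convexD[OF convex_convex_hull]) (auto simp: K_def)
    moreover have "(1 - q) *\<^sub>R (x, y) + q *\<^sub>R (real e, b0) = (x', y + q * (b0 - y))"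
      using qx by (simp add: algebra_simps)
    moreover have "q * (b0 - y) \<le> q * (s * (real e - x))"
      using above[OF that(1)] q(1) by (intro mult_left_mono) (auto simp: algebra_simps)
    moreover have "q * (s * (real e - x)) = s * (x' - x)"
      by (simp only: mult.left_commute[of q s] qx)
    moreover have "s * (x' - x) < u * (x' - x)" using that(2) \<open>s < u\<close> by simp
    ultimately show ?thesis by (intro exI[of _ "y + q * (b0 - y)"]) auto
  qed
  have term_high: "tm j k = 0" if "j * D < k" for j k
  proof -
    have "degree (F ^ j) < k" using degree_power_le[of F j] that by (simp add: D_def mult.commute)
    then show ?thesis by (simp add: tm_def coeff_eq_0)
  qed
  have term_lead: "padic_val p (tm j (j * D)) = padic_val p (coeff g j)" for j
  proof -
    have "degree (F ^ j) = j * D" using assms(3) by (subst degree_power_eq) (auto simp: D_def)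
    then have "coeff (F ^ j) (j * D) = lead_coeff F ^ j" by (metis lead_coeff_power)
    then show ?thesis
      by (simp add: tm_def padic_val_mult padic_val_power_eq_0 assms(1) lead)
  qed
  \<comment> \<open>After compression by \<open>D\<close>, index \<open>k\<close> sits to the right
    of \<open>e - j\<close>. The bounds on \<open>F\<close> put the term on or above the line of
    slope \<open>u\<close> from \<open>(e - j, b)\<close>, and \<open>ascend\<close> finds a hull
    point strictly below that line.\<close>
  have term_low: "\<exists>y'. (real e - real k / real D, y') \<in> K \<and> ereal y' < padic_val p (tm j k)"
    if j: "j \<le> e" "k < j * D" "tm j k \<noteq> 0" for j k
  proof -
    have "coeff g j \<noteq> 0" using that(3) by (auto simp: tm_def)
    then obtain b where b: "ereal b = padic_val p (coeff g j)" by (simp add: padic_val_def)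
    have "real k < real j * real D" using that(2) by (simp flip: of_nat_mult)
    then have lt: "real e - real j < real e - real k / real D" using D by (simp add: field_simps)
    then obtain y' where y': "(real e - real k / real D, y') \<in> K"
      "y' < b + u * (real e - real k / real D - (real e - real j))"
      using ascend[OF point[OF j(1) b] lt] by auto
    have "ereal y' < ereal b + ereal (real j * u - u / real D * real k)"
      using y'(2) by (simp add: algebra_simps)
    also have "\<dots> \<le> padic_val p (coeff g j) + padic_val p (coeff (F ^ j) k)"
      unfolding b D_def by (intro add_left_mono padic_val_coeff_power_ge assms(1) F) (simp add: assms(4))
    finally show ?thesis using y'(1) by (auto simp: tm_def padic_val_mult[OF assms(1)])
  qed
  show "real (degree F) > 0" using assms(3) by simp
  show "newton_polygon p (g \<circ>\<^sub>p F) = stretch (real (degree F)) ` newton_polygon p g"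
  proof (rule newton_polygon_stretch)
    show "real (degree F) > 0" using assms(3) by simp
    show "stretch (real (degree F)) ` newton_vertices p g \<subseteq> newton_points p (g \<circ>\<^sub>p F)"
    proof (rule image_subsetI)
      fix v assume v: "v \<in> newton_vertices p g"
      then have "v \<in> newton_points p g" using newton_vertices_subset_points by blast
      then obtain i y where i: "i \<le> e" "v = (real e - real i, y)" "ereal y = padic_val p (coeff g i)"
        by (auto simp: newton_points_def e_def)
      have lower: "(real e - real i, y) \<in> lower_boundary K"
        using v i(2) by (simp add: newton_vertices_def newton_polygon_eq K_def)
      \<comment> \<open>No cancellation at a vertex: for \<open>j < i\<close> the index exceeds the
        degree of \<open>F ^ j\<close>, and for \<open>j > i\<close> the term lies strictly above
        the polygon, whose height here is \<open>y\<close>.\<close>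
      have "ereal y < padic_val p (tm j (i * D))" if j: "j \<in> {..e} - {i}" for j
      proof (cases "tm j (i * D) = 0")
        case False
        then have "i < j" using that D term_high[of j "i * D"] by (cases i j rule: linorder_cases) auto
        then obtain y' where "(real e - real (i * D) / real D, y') \<in> K"
          "ereal y' < padic_val p (tm j (i * D))"
          using term_low[of j "i * D"] j False D by auto
        moreover from this(1) have "y \<le> y'" using lower_boundary_le[OF lower] D by simp
        ultimately show ?thesis by (meson ereal_less_eq(3) order.strict_trans1)
      qed simp
      then have "padic_val p (tm i (i * D)) < padic_val p (\<Sum>j\<in>{..e} - {i}. tm j (i * D))"
        unfolding term_lead i(3)[symmetric] by (intro padic_val_sum_gt assms(1)) auto
      then have "padic_val p (coeff (g \<circ>\<^sub>p F) (i * D)) = padic_val p (tm i (i * D))"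
        unfolding coeff_h using i(1)
        by (subst sum.remove[of _ i]) (auto intro: padic_val_add_eq[OF assms(1)])
      then have "ereal y = padic_val p (coeff (g \<circ>\<^sub>p F) (i * D))" using term_lead i(3) by simp
      from newton_pointsI[OF _ this] show "stretch (real (degree F)) v \<in> newton_points p (g \<circ>\<^sub>p F)"
        using i(1) by (simp add: deg stretch_def i(2) algebra_simps flip: D_def)
    qed
    fix x y assume "(x, y) \<in> newton_points p (g \<circ>\<^sub>p F)"
    then obtain k where k: "k \<le> e * D" "x = real (e * D) - real k"
      "ereal y = padic_val p (coeff (g \<circ>\<^sub>p F) k)"
      by (auto simp: newton_points_def deg)
    \<comment> \<open>If every hull point over this abscissa were higher than \<open>y\<close>, so
      would be every summand, and hence their sum, the coefficient of valuation
      \<open>y\<close>.\<close>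
    have "\<exists>y'\<le>y. (real e - real k / real D, y') \<in> K"
    proof (rule ccontr)
      assume none: "\<not> ?thesis"
      have "ereal y < padic_val p (tm j k)" if j: "j \<in> {..e}" for j
      proof (cases "tm j k = 0")
        case False
        then have "k = j * D \<or> k < j * D" using term_high[of j k] by linarith
        then obtain y' where y': "(real e - real k / real D, y') \<in> K" "ereal y' \<le> padic_val p (tm j k)"
        proof
          assume "k = j * D"
          moreover have "coeff g j \<noteq> 0" using False by (auto simp: tm_def)
          then obtain b where "ereal b = padic_val p (coeff g j)" by (simp add: padic_val_def)
          ultimately show ?thesis using point[of j b] j term_lead[of j] D by (intro that[of b]) auto
        next
          assume "k < j * D"
          then show ?thesis using term_low[of j k] False j that by (auto intro: less_imp_le)
        qed
        then have "y < y'" using none by (meson not_le)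
        then have "ereal y < ereal y'" by simp
        also note y'(2)
        finally show ?thesis .
      qed simp
      then have "ereal y < padic_val p (\<Sum>j\<le>e. tm j k)"
        by (intro padic_val_sum_gt assms(1)) auto
      then show False using k(3) by (simp add: coeff_h)
    qed
    then obtain y' where y': "y' \<le> y" "(real e - real k / real D, y') \<in> K" by blast
    have "(x, y') = stretch D (real e - real k / real D, y')"
      using D by (simp add: stretch_def k(2) right_diff_distrib)
    then have "(x, y') \<in> stretch D ` K" using y'(2) by (rule image_eqI)
    then show "\<exists>y'\<le>y. (x, y') \<in> stretch (real (degree F)) ` (convex hull newton_points p g)"
      using y'(1) unfolding K_def D_def by blast
  qed
qed

theorem corollary1p7:
  fixes p d e t \<beta> n :: nat
    and u :: int
    and f g :: "rat poly"
    and m :: "nat \<Rightarrow> nat"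
    and lam :: "nat \<Rightarrow> real"
  assumes "prime p"
    and "degree g = e"
    and "coeff g 0 \<noteq> 0"
    and "m 0 = e"
    and "m t = 0"
    and "successive_newton_vertices p g
           (map (\<lambda>i. (real e - real (m i), real_of_ereal (padic_val p (coeff g (m i))))) [0..<Suc t])"
    and "\<And>i. i \<in> {1..t} \<Longrightarrow>
           lam i = (real_of_ereal (padic_val p (coeff g (m i)))
                  - real_of_ereal (padic_val p (coeff g (m (i - 1)))))
                 / (real (m (i - 1)) - real (m i))"
    and "\<And>j. j \<in> {1..t} \<Longrightarrow> real_of_int u > \<bar>lam j\<bar>"
    and "degree f = d"
    and "padic_val p (coeff f d) = 0"
    and "0 < \<beta>" and "\<beta> \<le> d" and "coprime (int \<beta>) u"
    and "\<And>i. i \<in> {0..d} \<Longrightarrow>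
           padic_val p (coeff f i) \<ge> ereal (real_of_int u / real \<beta> * (real d - real i))"
    and "n > 0"
  shows "successive_newton_vertices p (pcompose g (poly_iterate f n))
           (map (\<lambda>i. (real (d ^ n) * (real e - real (m i)),
                       real_of_ereal (padic_val p (coeff g (m i))))) [0..<Suc t])"
proof -
  define val where "val = (\<lambda>i. real_of_ereal (padic_val p (coeff g (m i))))"
  define F where "F = poly_iterate f n"
  have d: "d > 0" using assms(11,12) by simp
  have decreasing: "m j < m i" if "i < j" "j \<le> t" for i j
  proof -
    let ?vs = "map (\<lambda>i. (real e - real (m i), val i)) [0..<Suc t]"
    have "sorted_wrt (\<lambda>v w. fst v < fst w) ?vs"
      using assms(6) by (simp add: successive_newton_vertices_def val_def)
    then have "fst (?vs ! i) < fst (?vs ! j)"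
      by (rule sorted_wrt_nth_less) (use that in \<open>simp_all del: upt_Suc\<close>)
    moreover have "?vs ! i = (real e - real (m i), val i)" "?vs ! j = (real e - real (m j), val j)"
      using that by (simp_all del: upt_Suc)
    ultimately show ?thesis by simp
  qed
  have vertices: "newton_vertices p g = (\<lambda>i. (real e - real (m i), val i)) ` {..t}"
    using assms(6)
    by (simp add: successive_newton_vertices_def val_def lessThan_Suc_atMost atLeast0LessThan
        del: upt_Suc)
  have "newton_vertices p (g \<circ>\<^sub>p F) = stretch (real (d ^ n)) ` newton_vertices p g"
  \<comment> \<open>A constant \<open>g\<close> has no slopes, so nothing forces
    \<open>u \<ge> 0\<close>; its only vertex has abscissa 0 and is fixed by the stretch. For
    \<open>e > 0\<close> there is a slope, and \<open>u\<close> exceeds its absolute value.\<close>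
  proof (cases "e = 0")
    case True
    then obtain c where "g = [:c:]" using assms(2) degree_eq_zeroE by blast
    moreover have "t = 0" using decreasing[of 0 t] assms(4) True by (cases t) auto
    ultimately show ?thesis using vertices True assms(4) by (simp add: stretch_def)
  next
    case False
    then have t: "t > 0" using assms(4,5) by (cases t) auto
    have u: "0 \<le> real_of_int u" using assms(8)[of t] t by fastforce
    \<comment> \<open>With the maximum over all edges, every edge rises at rate at most
      \<open>s\<close>, and \<open>s < u\<close> still holds.\<close>
    define s where "s = Max (lam ` {1..t})"
    have "s \<in> lam ` {1..t}" unfolding s_def using t by (intro Max_in) auto
    then have su: "s < real_of_int u" using assms(8) by fastforce
    have step_le: "val (Suc i) - val i \<le> s * (real (m i) - real (m (Suc i)))" if "i < t" for i
    proof -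
      have "lam (Suc i) \<le> s" unfolding s_def using that by (intro Max_ge) auto
      moreover have "lam (Suc i) = (val (Suc i) - val i) / (real (m i) - real (m (Suc i)))"
        using assms(7)[of "Suc i"] that by (simp add: val_def)
      moreover have "real (m i) - real (m (Suc i)) > 0" using decreasing[of i "Suc i"] that by simp
      ultimately show ?thesis by (simp add: divide_le_eq)
    qed
    \<comment> \<open>The edge bounds telescope from the last vertex backwards, starting from
      \<open>m t = 0\<close>. This is the line condition of \<open>newton_vertices_pcompose\<close>
      with \<open>b0 = val t\<close>.\<close>
    have below: "val t - s * real (m i) \<le> val i" if "i \<le> t" for i
      using that
    proof (induction i rule: inc_induct)
      case base
      then show ?case using assms(5) by simp
    next
      case (step i)
      then show ?case using step_le[of i] by (simp add: algebra_simps)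
    qed
    have "ereal (u - u / real (degree f) * real i) \<le> padic_val p (coeff f i)" for i
    proof (cases "i \<le> d")
      case True
      \<comment> \<open>Since \<open>u \<ge> 0\<close> and \<open>\<beta> \<le> d\<close>, replacing
        \<beta> by \<open>d\<close> weakens the bound to the form that is stable under
        iteration.\<close>
      have "u / real d * (real d - real i) \<le> u / real \<beta> * (real d - real i)"
        using True u assms(11,12) by (intro mult_right_mono divide_left_mono) auto
      moreover have "u - u / real d * real i = u / real d * (real d - real i)"
        using d by (simp add: right_diff_distrib)
      ultimately have "ereal (u - u / real d * real i) \<le> ereal (u / real \<beta> * (real d - real i))"
        by simp
      also have "\<dots> \<le> padic_val p (coeff f i)" using assms(14) True by simp
      finally show ?thesis by (simp add: assms(9))
    qed (simp add: coeff_eq_0 assms(9))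
    then have "ereal (u - u / real (degree F) * real k) \<le> padic_val p (coeff F k)" for k
      unfolding F_def degree_poly_iterate
      by (intro padic_val_coeff_poly_iterate_ge assms(1) u) (simp_all add: assms(9) d)
    moreover have "padic_val p (lead_coeff F) = 0"
      unfolding F_def by (intro padic_val_lead_coeff_poly_iterate) (simp_all add: assms d)
    moreover have "ereal (val t) = padic_val p (coeff g 0)"
      using assms(3) by (simp add: val_def assms(5) padic_val_def)
    moreover have "val t + s * (x - real (degree g)) \<le> y" if "(x, y) \<in> newton_vertices p g" for x y
      using that below by (auto simp: vertices assms(2))
    moreover have "degree F = d ^ n" by (simp add: F_def degree_poly_iterate assms(9))
    ultimately show ?thesis
      using newton_vertices_pcompose[of p g F "real_of_int u" "val t" s] assms(1,3) u su d by simp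
  qed
  then have "newton_vertices p (g \<circ>\<^sub>p F) =
      set (map (\<lambda>i. (real (d ^ n) * (real e - real (m i)), val i)) [0..<Suc t])"
    by (simp add: vertices image_image stretch_def lessThan_Suc_atMost atLeast0LessThan del: upt_Suc)
  moreover have "sorted_wrt (\<lambda>v w. fst v < fst w)
      (map (\<lambda>i. (real (d ^ n) * (real e - real (m i)), val i)) [0..<Suc t])"
    unfolding sorted_wrt_map using d decreasing
    by (auto simp: sorted_wrt_iff_nth_less simp del: upt_Suc)
  ultimately show ?thesis by (simp add: successive_newton_vertices_def F_def val_def)
qed

end
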